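(* Let $f$ be twice continuously differentiable with $\nabla^2 f(x)=\alpha\,\mathrm{Id}$ for all $x\in X$, for some $\alpha>0$, and suppose that $A^*:Y\to X$ is bounded from below with constant $\beta>0$, i.e. $\|A^*y\|_X^2\ge\beta\|y\|_Y^2$ for all $y\in Y$. Let $(x,\lambda):[0,+\infty)\to X\times Y$ be a solution of the Arrow--Hurwicz differential system (AH). Then, for $(\xi,\eta)\in S\times M$ (the unique saddle point of $L$), the following assertions hold: (i) If $\alpha^2<4\beta$, then, as $t\to+\infty$, $$L(x(t),\eta)-L(\xi,\lambda(t))=\mathcal O(e^{-\alpha t}),\quad \|(\dot x(t),\dot\lambda(t))\|^2=\mathcal O(e^{-\alpha t}),\quad \|(x(t),\lambda(t))-(\xi,\eta)\|^2=\mathcal O(e^{-\alpha t}).$$ (ii) If $\alpha^2=4\beta$, then, as $t\to+\infty$, $$L(x(t),\eta)-L(\xi,\lambda(t))=\mathcal O(t^2e^{-\alpha t}),\quad \|(\dot x(t),\dot\lambda(t))\|^2=\mathcal O(t^2e^{-\alpha t}),\quad \|(x(t),\lambda(t))-(\xi,\eta)\|^2=\mathcal O(t^2e^{-\alpha t}).$$ (iii) If $\alpha^2>4\beta$, then, with $\delta=\sqrt{\alpha^2-4\beta}$, as $t\to+\infty$, $$L(x(t),\eta)-L(\xi,\lambda(t))=\mathcal O(e^{-(\alpha-\delta)t}),\quad \|(\dot x(t),\dot\lambda(t))\|^2=\mathcal O(e^{-(\alpha-\delta)t}),\quad \|(x(t),\lambda(t))-(\xi,\eta)\|^2=\mathcal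 O(e^{-(\alpha-\delta)t}).$$
   Context: $X$ and $Y$ are real Hilbert spaces with inner products $\langle\cdot,\cdot\rangle_X$, $\langle\cdot,\cdot\rangle_Y$ and norms $\|\cdot\|_X,\|\cdot\|_Y$; $X\times Y$ carries the product Hilbert structure, with norm $\|\cdot\|$. Standing assumptions: $f:X\to\mathbb R$ is convex and continuously differentiable; $\nabla f:X\to X$ is Lipschitz continuous on bounded sets; $A:X\to Y$ is linear and continuous with adjoint $A^*$; $b\in Y$. $\nabla^2 f$ denotes the Hessian of $f$ and $\mathrm{Id}$ the identity operator. The Lagrangian is $L:X\times Y\to\mathbb R$, $L(x,\lambda)=f(x)+\langle\lambda,Ax-b\rangle_Y$. A saddle point of $L$ is a pair $(\bar x,\bar\lambda)\in X\times Y$ with $L(\bar x,\lambda)\le L(\bar x,\bar\lambda)\le L(x,\bar\lambda)$ for all $(x,\lambda)\in X\times Y$; the set of saddle points of $L$ is denoted by $S\times M\subset X\times Y$. Under the hypotheses of the claim, $S\times M$ consists of exactly one element. The system (AH) is $$\dot x+\nabla f(x)+A^*\lambda=0_X,\qquad \dot\lambda+b-Ax=0_Y,$$ with initial data $(x(0),\lambda(0))=(x_0,\lambda_0)\in X\times Y$; a solution is a function $(x,\lambda)\in\mathcal C^1([0,+\infty);X\times Y)$ satisfying the system on $[0,+\infty)$ with these initial data. *)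

theory Defs
  imports "HOL-Analysis.Analysis" "HOL-Library.Landau_Symbols"
begin

text \<open>
  Real Hilbert spaces are types of sort \<open>{real_inner, complete_space}\<close>; the product type carries
  the product inner product. The library constant \<^const>\<open>adjoint\<close> is a choice of an operator
  \<open>A'\<close> with \<open>A x \<bullet> y = x \<bullet> A' y\<close>; for a bounded operator between Hilbert spaces such an \<open>A'\<close>
  exists and is unique (Riesz), so it is the Hilbert space adjoint.
\<close>

definition C1_gradient ::
    "('a :: {real_inner, complete_space} \<Rightarrow> real) \<Rightarrow> ('a \<Rightarrow> 'a) \<Rightarrow> bool" where
  "C1_gradient f gradf \<longleftrightarrow> (\<forall>x. GDERIV f x :> gradf x) \<and> continuous_on UNIV gradf"

text \<open>The Hessian, as an operator on the space, is the Frechet derivative of the gradient.\<close>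

definition C2_hessian ::
    "('a :: {real_inner, complete_space} \<Rightarrow> real) \<Rightarrow> ('a \<Rightarrow> 'a) \<Rightarrow> ('a \<Rightarrow> 'a \<Rightarrow>\<^sub>L 'a) \<Rightarrow> bool" where
  "C2_hessian f gradf H \<longleftrightarrow> C1_gradient f gradf \<and>
     (\<forall>x. (gradf has_derivative blinfun_apply (H x)) (at x)) \<and> continuous_on UNIV H"

definition lipschitz_on_bounded_sets :: "('a :: metric_space \<Rightarrow> 'b :: metric_space) \<Rightarrow> bool" where
  "lipschitz_on_bounded_sets g \<longleftrightarrow> (\<forall>B. bounded B \<longrightarrow> (\<exists>C. C-lipschitz_on B g))"

definition lagrangian ::
    "('a :: {real_inner, complete_space} \<Rightarrow> real) \<Rightarrow> ('a \<Rightarrow>\<^sub>L 'b :: {real_inner, complete_space})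
     \<Rightarrow> 'b \<Rightarrow> 'a \<Rightarrow> 'b \<Rightarrow> real" where
  "lagrangian f A b x l = f x + l \<bullet> (blinfun_apply A x - b)"

definition saddle_points :: "('a \<Rightarrow> 'b \<Rightarrow> real) \<Rightarrow> ('a \<times> 'b) set" where
  "saddle_points L = {(\<xi>, \<eta>). \<forall>x l. L \<xi> l \<le> L \<xi> \<eta> \<and> L \<xi> \<eta> \<le> L x \<eta>}"

text \<open>Time derivative on the half-line; one-sided at \<open>0\<close>.\<close>

definition time_deriv :: "(real \<Rightarrow> 'a :: real_normed_vector) \<Rightarrow> real \<Rightarrow> 'a" where
  "time_deriv z t = vector_derivative z (at t within {0..})"

text \<open>The library's \<^const>\<open>C1_differentiable_on\<close> uses two-sided derivatives, which would require
  values at negative times.\<close>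

definition C1_halfline :: "(real \<Rightarrow> 'a :: real_normed_vector) \<Rightarrow> bool" where
  "C1_halfline z \<longleftrightarrow> z differentiable_on {0..} \<and> continuous_on {0..} (time_deriv z)"

definition AH_solution ::
    "('a :: {real_inner, complete_space} \<Rightarrow> 'a) \<Rightarrow> ('a \<Rightarrow>\<^sub>L 'b :: {real_inner, complete_space})
     \<Rightarrow> 'b \<Rightarrow> 'a \<Rightarrow> 'b \<Rightarrow> (real \<Rightarrow> 'a) \<Rightarrow> (real \<Rightarrow> 'b) \<Rightarrow> bool" where
  "AH_solution gradf A b x\<^sub>0 l\<^sub>0 x l \<longleftrightarrow>
     C1_halfline (\<lambda>t. (x t, l t)) \<and>
     (\<forall>t\<ge>0. time_deriv x t + gradf (x t) + adjoint (blinfun_apply A) (l t) = 0 \<and>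
            time_deriv l t + b - blinfun_apply A (x t) = 0) \<and>
     x 0 = x\<^sub>0 \<and> l 0 = l\<^sub>0"

end

theory Submission
  imports Defs
begin

text \<open>
  The gradient is affine with linear part \<open>\<alpha> Id\<close>, so the deviations \<open>u = x - \<xi>\<close> and \<open>v = l - \<eta>\<close>
  from the saddle point solve \<open>u' = - \<alpha> u - A\<^sup>* v\<close>, \<open>v' = A u\<close>; hence \<open>v'' + \<alpha> v' + A A\<^sup>* v = 0\<close>.
  The rescaling \<open>z = e\<^bsup>rt\<^esup> v\<close> gives \<open>z'' + \<delta> z' + (A A\<^sup>* - \<kappa>) z = 0\<close> with \<open>\<delta> = \<alpha> - 2 r\<close> and
  \<open>\<kappa> = r (\<alpha> - r)\<close>. With \<open>r = \<alpha> / 2\<close> in the first two cases and \<open>r = (\<alpha> - sqrt (\<alpha>\<^sup>2 - 4 \<beta>)) / 2\<close>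
  in the third, \<open>\<kappa> \<le> \<beta>\<close> and \<open>\<delta> \<ge> 0\<close>, so the energy
  \<open>(norm (z' + \<delta> z))\<^sup>2 / 2 + (norm z')\<^sup>2 / 2 + (A A\<^sup>* - \<kappa>) z \<bullet> z\<close> does not increase. It bounds \<open>z\<close> if
  \<open>\<delta> > 0\<close> or \<open>\<kappa> < \<beta>\<close>, and in the critical case it bounds \<open>z'\<close>, so that \<open>z\<close> grows at most
  linearly. The rate of \<open>u\<close> follows by integrating \<open>(e\<^bsup>\<alpha>t\<^esup> u)' = - e\<^bsup>\<alpha>t\<^esup> A\<^sup>* v\<close>, and the duality gap
  is \<open>\<alpha> / 2 * (norm u)\<^sup>2\<close>.
\<close>

section \<open>Riesz representation and adjoints\<close>

text \<open>For small \<open>s\<close> of sign opposite to \<open>a\<close> the linear term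
  dominates and the sum is negative. This is the first-order condition at a minimum, for the Riesz
  vector and for the saddle points alike.\<close>

lemma linear_coeff_zero_if_quadratic_nonneg:
  fixes a k :: real
  assumes "\<And>s. 0 \<le> s * a + s\<^sup>2 * k"
  shows "a = 0"
proof (rule ccontr)
  assume "a \<noteq> 0"
  define K where "K = \<bar>k\<bar> + 1"
  have K: "K > 0" "k - K \<le> - 1" by (auto simp: K_def)
  have "0 \<le> (- a / K) * a + (- a / K)\<^sup>2 * k" by (rule assms)
  also have "\<dots> = (a / K)\<^sup>2 * (k - K)"
    using K by (simp add: field_simps power2_eq_square)
  also have "\<dots> \<le> (a / K)\<^sup>2 * (- 1)"
    using K by (intro mult_left_mono) auto
  also have "\<dots> < 0" using \<open>a \<noteq> 0\<close> K by simp
  finally show False by simp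
qed

text \<open>The representing vector minimises \<open>\<lambda>x. (norm x)\<^sup>2 / 2 - \<phi> x\<close>; by the parallelogram law every
  minimising sequence is Cauchy.\<close>

lemma riesz_representation:
  fixes \<phi> :: "'a :: {real_inner, complete_space} \<Rightarrow> real"
  assumes "bounded_linear \<phi>"
  obtains r where "\<And>x. \<phi> x = x \<bullet> r"
proof -
  interpret \<phi>: bounded_linear \<phi> by fact
  define J where "J x = (norm x)\<^sup>2 / 2 - \<phi> x" for x
  obtain K where K: "\<And>x. norm (\<phi> x) \<le> norm x * K" using \<phi>.bounded by blast
  \<comment> \<open>Completing the square in \<open>norm x\<close>, with the bound \<open>K\<close>
    for \<open>\<phi>\<close>.\<close>
  have J_ge: "- K\<^sup>2 / 2 \<le> J x" for x
  proof -
    have "\<phi> x \<le> norm x * K" using K[of x] by simp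
    moreover have "0 \<le> (norm x - K)\<^sup>2" by simp
    ultimately show ?thesis by (simp add: J_def power2_diff)
  qed
  have bdd: "bdd_below (range J)" using J_ge by (auto intro!: bdd_belowI)
  define m where "m = Inf (range J)"
  have m_le: "m \<le> J x" for x unfolding m_def by (intro cInf_lower bdd) auto
  have "\<exists>x. J x < m + inverse (real (Suc n))" for n
    using cInf_lessD[of "range J" "m + inverse (real (Suc n))"] by (auto simp: m_def)
  then obtain s where s: "\<And>n. J (s n) < m + inverse (real (Suc n))" by metis
  \<comment> \<open>The linear part of \<open>J\<close> cancels at the midpoint and only the
    parallelogram law is left. As \<open>J\<close> is at least \<open>m\<close> at the midpoint, two
    nearly minimal points must be close.\<close>
  have mid: "(norm (x - y))\<^sup>2 / 4 = J x + J y - 2 * J ((1/2) *\<^sub>R (x + y))" for x y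
    unfolding J_def power2_norm_eq_inner
    by (simp add: \<phi>.scaleR \<phi>.add inner_simps inner_commute field_simps)
  have close: "(norm (s i - s j))\<^sup>2 < 4 * (inverse (real (Suc i)) + inverse (real (Suc j)))" for i j
  proof -
    have "J (s i) + J (s j) - 2 * J ((1/2) *\<^sub>R (s i + s j))
        < (m + inverse (real (Suc i))) + (m + inverse (real (Suc j))) - 2 * m"
      using add_strict_mono[OF s[of i] s[of j]] m_le[of "(1/2) *\<^sub>R (s i + s j)"] by argo
    with mid[of "s i" "s j"] show ?thesis by simp
  qed
  have "Cauchy s"
  proof (rule CauchyI)
    fix e :: real assume e: "0 < e"
    obtain N where N: "inverse (real (Suc N)) < e\<^sup>2 / 8"
      using reals_Archimedean[of "e\<^sup>2 / 8"] e by auto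
    have small: "inverse (real (Suc i)) < e\<^sup>2 / 8" if "i \<ge> N" for i
    proof -
      have "inverse (real (Suc i)) \<le> inverse (real (Suc N))"
        using that by (intro le_imp_inverse_le) auto
      with N show ?thesis by linarith
    qed
    show "\<exists>M. \<forall>i\<ge>M. \<forall>j\<ge>M. norm (s i - s j) < e"
    proof (intro exI allI impI)
      fix i j assume ij: "i \<ge> N" "j \<ge> N"
      have "(norm (s i - s j))\<^sup>2 < e\<^sup>2"
        using close[of i j] add_strict_mono[OF small[OF ij(1)] small[OF ij(2)]] by argo
      then show "norm (s i - s j) < e" by (rule power2_less_imp_less) (use e in simp)
    qed
  qed
  then obtain r where r: "s \<longlonglongrightarrow> r" using Cauchy_convergent convergent_def by blast
  have "(\<lambda>n. J (s n)) \<longlonglongrightarrow> J r"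
    unfolding J_def by (intro tendsto_intros \<phi>.tendsto r) simp
  moreover have "(\<lambda>n. m + inverse (real (Suc n))) \<longlonglongrightarrow> m + 0"
    by (intro tendsto_intros LIMSEQ_inverse_real_of_nat)
  ultimately have "J r \<le> m + 0"
    by (rule LIMSEQ_le) (use s less_imp_le in blast)
  then have J_min: "J r \<le> J x" for x using m_le[of x] by simp
  have "\<phi> h = h \<bullet> r" for h
  proof -
    \<comment> \<open>First-order condition for \<open>J\<close> at its minimiser \<open>r\<close>
      along the line in direction \<open>h\<close>.\<close>
    have "h \<bullet> r - \<phi> h = 0"
    proof (rule linear_coeff_zero_if_quadratic_nonneg)
      fix t :: real
      have "J (r + t *\<^sub>R h) - J r = t * (h \<bullet> r - \<phi> h) + t\<^sup>2 * ((norm h)\<^sup>2 / 2)"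
        unfolding J_def power2_norm_eq_inner
        by (simp add: \<phi>.scaleR \<phi>.add inner_simps inner_commute algebra_simps power2_eq_square)
      then show "0 \<le> t * (h \<bullet> r - \<phi> h) + t\<^sup>2 * ((norm h)\<^sup>2 / 2)"
        using J_min[of "r + t *\<^sub>R h"] by simp
    qed
    then show ?thesis by simp
  qed
  then show ?thesis by (rule that)
qed

text \<open>The constant \<open>adjoint\<close> is a Hilbert choice, so its characteristic identity
  needs a witness. Riesz, applied for each \<open>y\<close> to the functional pairing
  \<open>A x\<close> with \<open>y\<close>, supplies one.\<close>

lemma inner_adjoint_blinfun:
  fixes A :: "'a :: {real_inner, complete_space} \<Rightarrow>\<^sub>L 'b :: real_inner"
  shows "blinfun_apply A x \<bullet> y = x \<bullet> adjoint (blinfun_apply A) y"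
proof -
  have "\<exists>r. \<forall>x. blinfun_apply A x \<bullet> y = x \<bullet> r" for y
  proof -
    have "bounded_linear (\<lambda>x. blinfun_apply A x \<bullet> y)"
      by (intro bounded_linear_intros)
    then show ?thesis by (rule riesz_representation) blast
  qed
  then have "\<exists>g. \<forall>x y. blinfun_apply A x \<bullet> y = x \<bullet> g y" by metis
  then have "\<forall>x y. blinfun_apply A x \<bullet> y = x \<bullet> adjoint (blinfun_apply A) y"
    unfolding adjoint_def by (rule someI_ex)
  then show ?thesis by blast
qed

text \<open>Linearity follows by testing against all vectors. The norm bound comes from pairing
  \<open>A (?A' y)\<close> with \<open>y\<close>, where one factor \<open>norm (?A' y)\<close>
  cancels.\<close>

lemma bounded_linear_adjoint_blinfun:
  fixes A :: "'a :: {real_inner, complete_space} \<Rightarrow>\<^sub>L 'b :: real_inner"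
  shows "bounded_linear (adjoint (blinfun_apply A))"
proof (rule bounded_linear_intro)
  let ?A' = "adjoint (blinfun_apply A)"
  show "?A' (y + z) = ?A' y + ?A' z" for y z
    by (rule vector_eq_ldot[THEN iffD1])
      (simp add: inner_add_right flip: inner_adjoint_blinfun)
  show "?A' (s *\<^sub>R y) = s *\<^sub>R ?A' y" for s y
    by (rule vector_eq_ldot[THEN iffD1]) (simp flip: inner_adjoint_blinfun)
  show "norm (?A' y) \<le> norm y * norm A" for y
  proof (cases "?A' y = 0")
    case False
    have "norm (?A' y) * norm (?A' y) = blinfun_apply A (?A' y) \<bullet> y"
      by (simp add: inner_adjoint_blinfun power2_norm_eq_inner flip: power2_eq_square)
    also have "\<dots> \<le> norm (blinfun_apply A (?A' y)) * norm y"
      by (rule norm_cauchy_schwarz)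
    also have "\<dots> \<le> norm A * norm (?A' y) * norm y"
      by (intro mult_right_mono norm_blinfun norm_ge_zero)
    finally have "norm (?A' y) * norm (?A' y) \<le> (norm y * norm A) * norm (?A' y)"
      by (simp add: ac_simps)
    then show ?thesis using False by simp
  qed simp
qed

text \<open>For small \<open>s > 0\<close> the map \<open>\<lambda>y. y - s *\<^sub>R (B y - w)\<close> is a contraction.\<close>

lemma coercive_bounded_linear_bij:
  fixes B :: "'b :: {real_inner, complete_space} \<Rightarrow> 'b"
  assumes "bounded_linear B" and \<beta>: "\<beta> > 0"
    and coercive: "\<And>y. \<beta> * (norm y)\<^sup>2 \<le> B y \<bullet> y"
  shows "\<exists>!y. B y = w"
proof -
  interpret B: bounded_linear B by fact
  obtain K where K: "K > 0" "\<And>y. norm (B y) \<le> norm y * K" using B.pos_bounded by blast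
  \<comment> \<open>Adding \<beta> to the bound \<open>K\<close> ensures
    \<open>\<beta> / M \<le> 1\<close>, hence \<open>q \<ge> 0\<close>.\<close>
  define M where "M = K + \<beta>"
  have M: "M > 0" "\<beta> \<le> M" "\<And>y. norm (B y) \<le> M * norm y"
    using K \<beta> by (auto simp: M_def algebra_simps intro: order_trans[OF K(2)])
  \<comment> \<open>This \<open>s\<close> minimises
    \<open>1 - 2 * s * \<beta> + s\<^sup>2 * M\<^sup>2\<close>, the factor bounding the squared norm
    of \<open>v - s *\<^sub>R B v\<close>; the minimum is \<open>q\<close>.\<close>
  define s where "s = \<beta> / M\<^sup>2"
  define q where "q = 1 - (\<beta> / M)\<^sup>2"
  have s: "s > 0" using \<beta> M by (simp add: s_def)
  have ratio: "0 < \<beta> / M" "\<beta> / M \<le> 1" using \<beta> M by auto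
  have q: "0 \<le> q" "q < 1"
    using ratio power_le_one[of "\<beta> / M" 2] by (auto simp: q_def)
  define F where "F y = y - s *\<^sub>R (B y - w)" for y
  have sq: "(norm (v - s *\<^sub>R B v))\<^sup>2 \<le> q * (norm v)\<^sup>2" for v
  proof -
    have "(norm (v - s *\<^sub>R B v))\<^sup>2 = (norm v)\<^sup>2 - 2 * s * (B v \<bullet> v) + s\<^sup>2 * (norm (B v))\<^sup>2"
      unfolding power2_norm_eq_inner
      by (simp add: inner_simps inner_commute algebra_simps power2_eq_square)
    also have "\<dots> \<le> (norm v)\<^sup>2 - 2 * s * (\<beta> * (norm v)\<^sup>2) + s\<^sup>2 * (M * norm v)\<^sup>2"
      using s by (intro add_mono diff_mono mult_left_mono coercive power_mono M) auto
    also have "\<dots> = q * (norm v)\<^sup>2"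
      using M by (simp add: s_def q_def field_simps power2_eq_square)
    finally show ?thesis .
  qed
  have "dist (F y) (F z) \<le> sqrt q * dist y z" for y z
  proof -
    have "F y - F z = (y - z) - s *\<^sub>R B (y - z)"
      by (simp add: F_def B.diff algebra_simps)
    then have "(norm (F y - F z))\<^sup>2 \<le> (sqrt q * norm (y - z))\<^sup>2"
      using sq[of "y - z"] q by (simp add: power_mult_distrib)
    then show ?thesis unfolding dist_norm by (rule power2_le_imp_le) (use q in simp)
  qed
  then have "\<exists>!y. F y = y"
    using q by (intro banach_fix_type[of "sqrt q"]) (auto simp: real_sqrt_lt_1_iff)
  moreover have "F y = y \<longleftrightarrow> B y = w" for y
    using s by (simp add: F_def)
  ultimately show ?thesis by simp
qed

section \<open>Saddle points\<close>

text \<open>Subtracting \<open>\<alpha> *\<^sub>R u\<close> from the gradient leaves a map with zero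
  derivative on the whole space, hence a constant.\<close>

lemma affine_gradient_if_hessian_scalar:
  assumes "C2_hessian f gradf H" and "\<And>u. H u = \<alpha> *\<^sub>R id_blinfun"
  shows "gradf x = \<alpha> *\<^sub>R (x - y) + gradf y"
proof -
  let ?g = "\<lambda>u. gradf u - \<alpha> *\<^sub>R u"
  have "(?g has_derivative (\<lambda>h. 0)) (at u)" for u
  proof -
    have "(gradf has_derivative blinfun_apply (H u)) (at u)"
      using assms(1) unfolding C2_hessian_def by blast
    then have "(?g has_derivative (\<lambda>h. blinfun_apply (H u) h - \<alpha> *\<^sub>R h)) (at u)"
      by (intro derivative_intros)
    then show ?thesis by (simp add: assms(2) scaleR_blinfun.rep_eq)
  qed
  then have "?g x = ?g y"
    by (intro has_derivative_zero_unique[of UNIV]) auto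
  then show ?thesis by (simp add: algebra_simps)
qed

text \<open>The second-order Taylor formula without remainder: by the affine form of the gradient,
  \<open>f\<close> minus its Taylor polynomial at \<open>y\<close> has zero derivative
  everywhere.\<close>

lemma quadratic_expansion_if_hessian_scalar:
  assumes C2: "C2_hessian f gradf H" and hess: "\<And>u. H u = \<alpha> *\<^sub>R id_blinfun"
  shows "f x = f y + gradf y \<bullet> (x - y) + \<alpha> / 2 * (norm (x - y))\<^sup>2"
proof -
  let ?g = "\<lambda>u. f u - (gradf y \<bullet> (u - y) + \<alpha> / 2 * ((u - y) \<bullet> (u - y)))"
  have "(?g has_derivative (\<lambda>h. 0)) (at u)" for u
  proof -
    have f: "(f has_derivative (\<lambda>h. h \<bullet> gradf u)) (at u)"
      using C2 unfolding C2_hessian_def C1_gradient_def gderiv_def by blast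
    show ?thesis
      by (auto intro!: derivative_eq_intros f ext
          simp: affine_gradient_if_hessian_scalar[OF C2 hess, of u y] inner_simps inner_commute
            algebra_simps)
  qed
  then have "?g x = ?g y"
    by (intro has_derivative_zero_unique[of UNIV]) auto
  then show ?thesis by (simp add: power2_norm_eq_inner)
qed

text \<open>In the multiplier the Lagrangian is affine, so a maximum forces the residual of the
  constraint to vanish. In the primal variable it is quadratic with curvature \<alpha>, so
  minimality amounts to a vanishing gradient.\<close>

lemma saddle_points_lagrangian_iff:
  assumes C2: "C2_hessian f gradf H" and hess: "\<And>u. H u = \<alpha> *\<^sub>R id_blinfun" and "\<alpha> \<ge> 0"
  shows "(\<xi>, \<eta>) \<in> saddle_points (lagrangian f A b) \<longleftrightarrow>
    blinfun_apply A \<xi> = b \<and> gradf \<xi> + adjoint (blinfun_apply A) \<eta> = 0"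
proof -
  let ?A' = "adjoint (blinfun_apply A)"
  have L: "lagrangian f A b x \<eta> - lagrangian f A b \<xi> \<eta>
      = (gradf \<xi> + ?A' \<eta>) \<bullet> (x - \<xi>) + \<alpha> / 2 * (norm (x - \<xi>))\<^sup>2" for x
  proof -
    have "\<eta> \<bullet> blinfun_apply A (x - \<xi>) = ?A' \<eta> \<bullet> (x - \<xi>)"
      by (metis inner_adjoint_blinfun inner_commute)
    then show ?thesis
      using quadratic_expansion_if_hessian_scalar[OF C2 hess, of x \<xi>]
      by (simp add: lagrangian_def blinfun.diff_right inner_simps)
  qed
  show ?thesis
  proof
    assume "(\<xi>, \<eta>) \<in> saddle_points (lagrangian f A b)"
    then have max: "lagrangian f A b \<xi> l \<le> lagrangian f A b \<xi> \<eta>"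
      and min: "lagrangian f A b \<xi> \<eta> \<le> lagrangian f A b x \<eta>" for x l
      unfolding saddle_points_def by auto
    \<comment> \<open>Moving \<open>\<eta>\<close> along the residual \<open>A \<xi> - b\<close>
      raises the Lagrangian by the squared norm of the residual.\<close>
    have "(blinfun_apply A \<xi> - b) \<bullet> (blinfun_apply A \<xi> - b) \<le> 0"
      using max[of "\<eta> + (blinfun_apply A \<xi> - b)"] by (simp add: lagrangian_def inner_add_left)
    then have "blinfun_apply A \<xi> = b"
      by (metis eq_iff_diff_eq_0 inner_eq_zero_iff inner_ge_zero order_antisym)
    moreover let ?g = "gradf \<xi> + ?A' \<eta>"
    \<comment> \<open>The test direction is the gradient \<open>?g\<close> itself.\<close>
    have "?g \<bullet> ?g = 0"
    proof (rule linear_coeff_zero_if_quadratic_nonneg)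
      fix s :: real
      show "0 \<le> s * (?g \<bullet> ?g) + s\<^sup>2 * (\<alpha> / 2 * (norm ?g)\<^sup>2)"
        using min[of "\<xi> + s *\<^sub>R ?g"] L[of "\<xi> + s *\<^sub>R ?g"]
        by (simp add: power_mult_distrib ac_simps)
    qed
    ultimately show "blinfun_apply A \<xi> = b \<and> ?g = 0" by simp
  next
    assume crit: "blinfun_apply A \<xi> = b \<and> gradf \<xi> + ?A' \<eta> = 0"
    then have "lagrangian f A b \<xi> \<eta> \<le> lagrangian f A b x \<eta>" for x
    proof -
      have "0 \<le> lagrangian f A b x \<eta> - lagrangian f A b \<xi> \<eta>"
        unfolding L using crit \<open>\<alpha> \<ge> 0\<close> by simp
      then show ?thesis by simp
    qed
    with crit show "(\<xi>, \<eta>) \<in> saddle_points (lagrangian f A b)"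
      unfolding saddle_points_def by (simp add: lagrangian_def)
  qed
qed

text \<open>Solving the gradient equation for \<open>\<xi>\<close> leaves one linear equation for
  \<open>\<eta>\<close> with operator \<open>?B\<close>, which is coercive because
  \<open>?A'\<close> is bounded from below.\<close>

lemma ex1_saddle_point_lagrangian:
  assumes C2: "C2_hessian f gradf H" and hess: "\<And>u. H u = \<alpha> *\<^sub>R id_blinfun" and \<alpha>: "\<alpha> > 0"
    and \<beta>: "\<beta> > 0"
    and bounded_below: "\<And>y. (norm (adjoint (blinfun_apply A) y))\<^sup>2 \<ge> \<beta> * (norm y)\<^sup>2"
  shows "\<exists>!p. p \<in> saddle_points (lagrangian f A b)"
proof -
  let ?A' = "adjoint (blinfun_apply A)"
  let ?B = "\<lambda>y. blinfun_apply A (?A' y)"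
  interpret A': bounded_linear ?A' by (rule bounded_linear_adjoint_blinfun)
  have "bounded_linear ?B"
    by (intro bounded_linear_compose[OF blinfun.bounded_linear_right A'.bounded_linear_axioms])
  moreover have "\<beta> * (norm y)\<^sup>2 \<le> ?B y \<bullet> y" for y
    using bounded_below[of y] by (simp add: inner_adjoint_blinfun power2_norm_eq_inner)
  ultimately have ex1: "\<exists>!\<eta>. ?B \<eta> = - (\<alpha> *\<^sub>R b + blinfun_apply A (gradf 0))"
    using \<beta> by (intro coercive_bounded_linear_bij)
  have gradf: "gradf \<xi> = \<alpha> *\<^sub>R \<xi> + gradf 0" for \<xi>
    using affine_gradient_if_hessian_scalar[OF C2 hess, of \<xi> 0] by simp
  have saddle: "(\<xi>, \<eta>) \<in> saddle_points (lagrangian f A b) \<longleftrightarrow>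
      \<xi> = - (1 / \<alpha>) *\<^sub>R (gradf 0 + ?A' \<eta>) \<and>
      ?B \<eta> = - (\<alpha> *\<^sub>R b + blinfun_apply A (gradf 0))" for \<xi> \<eta>
  proof -
    have "gradf \<xi> + ?A' \<eta> = 0 \<longleftrightarrow> \<alpha> *\<^sub>R \<xi> = - (gradf 0 + ?A' \<eta>)"
      unfolding gradf[of \<xi>] add.assoc by (rule eq_neg_iff_add_eq_0[symmetric])
    also have "\<dots> \<longleftrightarrow> \<alpha> *\<^sub>R \<xi> = \<alpha> *\<^sub>R (- (1 / \<alpha>) *\<^sub>R (gradf 0 + ?A' \<eta>))"
      using \<alpha> by simp
    also have "\<dots> \<longleftrightarrow> \<xi> = - (1 / \<alpha>) *\<^sub>R (gradf 0 + ?A' \<eta>)"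
      unfolding scaleR_cancel_left using \<alpha> by simp
    finally have 1: "gradf \<xi> + ?A' \<eta> = 0 \<longleftrightarrow> \<xi> = - (1 / \<alpha>) *\<^sub>R (gradf 0 + ?A' \<eta>)" .
    \<comment> \<open>Applying \<open>A\<close> to the formula for \<open>\<xi>\<close> and
      multiplying by \<alpha> turns the constraint into an equation for \<open>\<eta>\<close>
      alone.\<close>
    have 2: "blinfun_apply A \<xi> = b \<longleftrightarrow> ?B \<eta> = - (\<alpha> *\<^sub>R b + blinfun_apply A (gradf 0))"
      if "\<xi> = - (1 / \<alpha>) *\<^sub>R (gradf 0 + ?A' \<eta>)"
    proof -
      have "\<alpha> *\<^sub>R blinfun_apply A \<xi> = - (blinfun_apply A (gradf 0) + ?B \<eta>)"
        using \<alpha> unfolding that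
        by (simp add: blinfun.scaleR_right blinfun.add_right blinfun.minus_right)
      moreover have "blinfun_apply A \<xi> = b \<longleftrightarrow> \<alpha> *\<^sub>R blinfun_apply A \<xi> = \<alpha> *\<^sub>R b"
        using \<alpha> by simp
      moreover have "- (p + q) = w \<longleftrightarrow> q = - (w + p)" for p q w :: 'b
        by (auto simp: algebra_simps)
      ultimately show ?thesis by simp
    qed
    show ?thesis
      unfolding saddle_points_lagrangian_iff[OF C2 hess less_imp_le[OF \<alpha>]] using 1 2 by blast
  qed
  obtain \<eta> where \<eta>: "?B \<eta> = - (\<alpha> *\<^sub>R b + blinfun_apply A (gradf 0))"
    and unique: "\<And>\<eta>'. ?B \<eta>' = - (\<alpha> *\<^sub>R b + blinfun_apply A (gradf 0)) \<Longrightarrow> \<eta>' = \<eta>"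
    using ex1 by (elim ex1E) blast
  show ?thesis
  proof (rule ex1I)
    show "(- (1 / \<alpha>) *\<^sub>R (gradf 0 + ?A' \<eta>), \<eta>) \<in> saddle_points (lagrangian f A b)"
      unfolding saddle using \<eta> by blast
  next
    fix p assume p: "p \<in> saddle_points (lagrangian f A b)"
    obtain \<xi>' \<eta>' where p_eq: "p = (\<xi>', \<eta>')" by (cases p)
    then have "\<xi>' = - (1 / \<alpha>) *\<^sub>R (gradf 0 + ?A' \<eta>')" "\<eta>' = \<eta>"
      using p unique saddle by blast+
    then show "p = (- (1 / \<alpha>) *\<^sub>R (gradf 0 + ?A' \<eta>), \<eta>)"
      unfolding p_eq by blast
  qed
qed

section \<open>Decay of the linear flow\<close>

lemma halfline_has_vector_derivative_imp_at:
  fixes t :: real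
  assumes "(z has_vector_derivative D) (at t within {0..})" "t > 0"
  shows "(z has_vector_derivative D) (at t)"
proof -
  have "at t within {0..} = at t"
    using assms(2) by (intro at_within_interior) simp
  with assms(1) show ?thesis by simp
qed

lemma halfline_continuous_on:
  fixes z :: "real \<Rightarrow> 'a :: real_normed_vector"
  assumes "\<And>t. t \<ge> 0 \<Longrightarrow> (z has_vector_derivative z' t) (at t within {0..})"
  shows "continuous_on {0..} z"
  using assms by (intro continuous_on_vector_derivative[where f' = z']) auto

text \<open>The mean value inequality with a varying majorant. It replaces integration: a constant
  majorant \<open>\<phi>'\<close> gives linear growth, an exponential one the rate of
  \<open>u\<close>.\<close>

lemma halfline_norm_increment_le:
  fixes z :: "real \<Rightarrow> 'a :: real_normed_vector" and \<phi> :: "real \<Rightarrow> real"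
  assumes z: "\<And>t. t \<ge> 0 \<Longrightarrow> (z has_vector_derivative z' t) (at t within {0..})"
    and \<phi>: "\<And>t. t \<ge> 0 \<Longrightarrow> (\<phi> has_vector_derivative \<phi>' t) (at t within {0..})"
    and le: "\<And>t. t \<ge> 0 \<Longrightarrow> norm (z' t) \<le> \<phi>' t"
    and t: "t \<ge> 0"
  shows "norm (z t - z 0) \<le> \<phi> t - \<phi> 0"
proof (cases "t = 0")
  case False
  show ?thesis
  proof (rule differentiable_bound_general[where f' = z' and \<phi>' = \<phi>'])
    show "continuous_on {0..t} z" "continuous_on {0..t} \<phi>"
      using halfline_continuous_on[of z z'] halfline_continuous_on[of \<phi> \<phi>'] z \<phi>
      by (auto intro: continuous_on_subset[of "{0..}"])
    fix s assume "0 < s" "s < t"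
    then show "(z has_vector_derivative z' s) (at s)" "(\<phi> has_vector_derivative \<phi>' s) (at s)"
      "norm (z' s) \<le> \<phi>' s"
      by (auto intro!: halfline_has_vector_derivative_imp_at z \<phi> le)
  qed (use False t in auto)
qed simp

lemma halfline_nonincreasing:
  fixes E :: "real \<Rightarrow> real"
  assumes E: "\<And>t. t \<ge> 0 \<Longrightarrow> (E has_vector_derivative E' t) (at t within {0..})"
    and le: "\<And>t. t \<ge> 0 \<Longrightarrow> E' t \<le> 0"
    and t: "t \<ge> 0"
  shows "E t \<le> E 0"
proof (rule DERIV_nonpos_imp_decreasing_open[OF t])
  show "continuous_on {0..t} E"
    using halfline_continuous_on[of E E'] E by (auto intro: continuous_on_subset[of "{0..}"])
  fix s :: real assume "0 < s"
  then have "(E has_real_derivative E' s) (at s)"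
    using halfline_has_vector_derivative_imp_at[OF E]
    by (simp add: has_real_derivative_iff_has_vector_derivative)
  then show "\<exists>y. (E has_real_derivative y) (at s) \<and> y \<le> 0"
    using le \<open>0 < s\<close> by auto
qed

section \<open>Energy estimate for the rescaled second-order equation\<close>

lemma has_real_derivative_inner_self:
  fixes w :: "real \<Rightarrow> 'a :: real_inner"
  assumes "(w has_vector_derivative w') (at t within S)"
  shows "((\<lambda>t. w t \<bullet> w t) has_real_derivative 2 * (w t \<bullet> w')) (at t within S)"
  unfolding has_real_derivative_iff_has_vector_derivative
  by (rule has_vector_derivative_eq_rhs[OF
        bounded_bilinear.has_vector_derivative[OF bounded_bilinear_inner assms assms]])
     (simp add: inner_commute)

text \<open>The factor \<open>1 + c * t\<close> covers boundedness (\<open>c = 0\<close>) and linear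
  growth (\<open>c > 0\<close>) together. If \<open>\<delta> = 0\<close> and
  \<open>\<kappa> = \<beta>\<close>, the quadratic form \<open>Q\<close> may vanish on some nonzero
  \<open>w\<close>, and then \<open>t *\<^sub>R w\<close> is a solution; hence the condition
  \<open>nondegenerate\<close>.\<close>

lemma damped_oscillator_growth:
  fixes A :: "'a :: {real_inner, complete_space} \<Rightarrow>\<^sub>L 'b :: {real_inner, complete_space}"
    and z y :: "real \<Rightarrow> 'b"
  defines "A' \<equiv> adjoint (blinfun_apply A)"
  assumes bounded_below: "\<And>y. (norm (A' y))\<^sup>2 \<ge> \<beta> * (norm y)\<^sup>2"
    and z: "\<And>t. t \<ge> 0 \<Longrightarrow> (z has_vector_derivative y t) (at t within {0..})"
    and y: "\<And>t. t \<ge> 0 \<Longrightarrow> (y has_vector_derivative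
              - \<delta> *\<^sub>R y t - (blinfun_apply A (A' (z t)) - \<kappa> *\<^sub>R z t)) (at t within {0..})"
    and \<delta>: "\<delta> \<ge> 0" and \<kappa>: "\<kappa> \<le> \<beta>" and c: "c \<ge> 0"
    and nondegenerate: "\<delta> > 0 \<or> \<kappa> < \<beta> \<or> c > 0"
  obtains K where "K \<ge> 0" "\<And>t. t \<ge> 0 \<Longrightarrow> norm (z t) \<le> K * (1 + c * t)"
proof -
  interpret A': bounded_linear A' unfolding A'_def by (rule bounded_linear_adjoint_blinfun)
  define B where "B v = blinfun_apply A (A' v) - \<kappa> *\<^sub>R v" for v
  define Q where "Q v = A' v \<bullet> A' v - \<kappa> * (v \<bullet> v)" for v
  have Q_ge: "(\<beta> - \<kappa>) * (norm v)\<^sup>2 \<le> Q v" for v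
    using bounded_below[of v] by (simp add: Q_def power2_norm_eq_inner algebra_simps)
  have Q_nonneg: "0 \<le> Q v" for v
    using Q_ge[of v] \<kappa> by (meson diff_ge_0_iff_ge mult_nonneg_nonneg order_trans zero_le_power2)
  have B_inner: "B v \<bullet> w = A' v \<bullet> A' w - \<kappa> * (v \<bullet> w)" for v w
    by (simp add: B_def A'_def inner_diff_left inner_adjoint_blinfun)
  have y: "(y has_vector_derivative - \<delta> *\<^sub>R y t - B (z t)) (at t within {0..})" if "t \<ge> 0" for t
    using y[OF that] by (simp add: B_def)
  \<comment> \<open>Adding \<open>\<delta> *\<^sub>R z t\<close> absorbs the friction term: the
    derivative of \<open>p\<close> is the pure restoring force.\<close>
  define p where "p t = y t + \<delta> *\<^sub>R z t" for t
  have p: "(p has_vector_derivative - B (z t)) (at t within {0..})" if "t \<ge> 0" for t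
    unfolding p_def by (auto intro!: derivative_eq_intros y z that)
  have A'z: "((\<lambda>t. A' (z t)) has_vector_derivative A' (y t)) (at t within {0..})"
    if "t \<ge> 0" for t
    by (rule A'.has_vector_derivative[OF z[OF that]])
  \<comment> \<open>The weights make the products of \<open>B (z t)\<close> with \<open>y t\<close>
    cancel: \<open>p\<close> and \<open>y\<close> contribute one each with a minus sign,
    \<open>Q\<close> contributes two. What remains is dissipation with factor \<delta>.\<close>
  define E where "E t = (p t \<bullet> p t + y t \<bullet> y t) / 2 + Q (z t)" for t
  have E: "(E has_vector_derivative - \<delta> * (Q (z t) + y t \<bullet> y t)) (at t within {0..})"
    if t: "t \<ge> 0" for t
  proof -
    have "(E has_real_derivative
        (2 * (p t \<bullet> - B (z t)) + 2 * (y t \<bullet> (- \<delta> *\<^sub>R y t - B (z t)))) / 2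
          + (2 * (A' (z t) \<bullet> A' (y t)) - \<kappa> * (2 * (z t \<bullet> y t)))) (at t within {0..})"
      unfolding E_def Q_def
      by (intro DERIV_add DERIV_diff DERIV_cdivide DERIV_cmult has_real_derivative_inner_self
          p y z A'z t)
    also have "(2 * (p t \<bullet> - B (z t)) + 2 * (y t \<bullet> (- \<delta> *\<^sub>R y t - B (z t)))) / 2
          + (2 * (A' (z t) \<bullet> A' (y t)) - \<kappa> * (2 * (z t \<bullet> y t)))
        = - \<delta> * (Q (z t) + y t \<bullet> y t)"
      by (simp add: p_def Q_def B_inner inner_simps inner_commute[of _ "B _"] field_simps)
    finally show ?thesis by (simp add: has_real_derivative_iff_has_vector_derivative)
  qed
  have E_le: "E t \<le> E 0" if "t \<ge> 0" for t
    by (rule halfline_nonincreasing[OF E _ that]) (simp_all add: \<delta> Q_nonneg)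
  have parts: "(norm (p t))\<^sup>2 \<le> 2 * E 0" "(norm (y t))\<^sup>2 \<le> 2 * E 0" "Q (z t) \<le> E 0"
    if "t \<ge> 0" for t
  proof -
    have le: "a \<le> 2 * e \<and> b \<le> 2 * e \<and> q \<le> e"
      if "(a + b) / 2 + q \<le> e" "0 \<le> a" "0 \<le> b" "0 \<le> q" for a b q e :: real
      using that by (simp add: field_simps)
    have "((norm (p t))\<^sup>2 + (norm (y t))\<^sup>2) / 2 + Q (z t) \<le> E 0"
      using E_le[OF that] unfolding E_def[of t] power2_norm_eq_inner .
    from le[OF this zero_le_power2 zero_le_power2 Q_nonneg]
    show "(norm (p t))\<^sup>2 \<le> 2 * E 0" "(norm (y t))\<^sup>2 \<le> 2 * E 0" "Q (z t) \<le> E 0" by blast+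
  qed
  define M where "M = sqrt (2 * E 0)"
  have M: "norm (p t) \<le> M" "norm (y t) \<le> M" if "t \<ge> 0" for t
    using parts(1,2)[OF that, THEN real_le_rsqrt] unfolding M_def .
  have M_nonneg: "M \<ge> 0" using M(1)[of 0] norm_ge_zero[of "p 0"] by linarith
  \<comment> \<open>In turn: \<open>z\<close> is recovered from the bounded difference
    \<open>p - y\<close>; \<open>Q\<close> is coercive and bounds \<open>z\<close>; the bounded
    velocity \<open>y\<close> is integrated.\<close>
  consider "\<delta> > 0" | "\<kappa> < \<beta>" | "c > 0" using nondegenerate by blast
  then show ?thesis
  proof cases
    case 1
    show ?thesis
    proof (rule that)
      show "2 * M / \<delta> \<ge> 0" using 1 M_nonneg by simp
      fix t :: real assume t: "t \<ge> 0"
      have "\<delta> * norm (z t) = norm (p t - y t)" using \<delta> by (simp add: p_def)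
      also have "\<dots> \<le> 2 * M" using M[OF t] norm_triangle_ineq4[of "p t" "y t"] by linarith
      finally have "norm (z t) \<le> 2 * M / \<delta> * 1" using 1 by (simp add: field_simps)
      also have "\<dots> \<le> 2 * M / \<delta> * (1 + c * t)"
        using 1 M_nonneg c t by (intro mult_left_mono) auto
      finally show "norm (z t) \<le> 2 * M / \<delta> * (1 + c * t)" .
    qed
  next
    case 2
    define K where "K = sqrt (E 0 / (\<beta> - \<kappa>))"
    have z_le: "norm (z t) \<le> K" if "t \<ge> 0" for t
      unfolding K_def using order_trans[OF Q_ge parts(3)[OF that]] 2
      by (intro real_le_rsqrt) (simp add: field_simps)
    have K: "K \<ge> 0" using z_le[of 0] norm_ge_zero[of "z 0"] by linarith
    show ?thesis
    proof (rule that[OF K])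
      fix t :: real assume t: "t \<ge> 0"
      have "K * 1 \<le> K * (1 + c * t)" using K c t by (intro mult_left_mono) auto
      then show "norm (z t) \<le> K * (1 + c * t)" using z_le[OF t] by simp
    qed
  next
    case 3
    show ?thesis
    proof (rule that)
      show "norm (z 0) + M / c \<ge> 0" using 3 M_nonneg by simp
      fix t :: real assume t: "t \<ge> 0"
      have "norm (z t - z 0) \<le> M * t - M * 0"
        by (rule halfline_norm_increment_le[OF z _ M(2) t]) (auto intro!: derivative_eq_intros)
      then have "norm (z t) \<le> norm (z 0) + M * t"
        using norm_triangle_sub[of "z t" "z 0"] by simp
      also have "\<dots> \<le> norm (z 0) + M * t + (norm (z 0) * c * t + M / c)"
        using 3 M_nonneg t by simp
      also have "\<dots> = (norm (z 0) + M / c) * (1 + c * t)" using 3 by (simp add: field_simps)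
      finally show "norm (z t) \<le> (norm (z 0) + M / c) * (1 + c * t)" .
    qed
  qed
qed

text \<open>The oscillator bound gives the rate of \<open>v\<close>. Since
  \<open>r < \<alpha>\<close>, the damping of \<open>u\<close> is faster than the decay of its
  forcing by \<open>v\<close>, so \<open>u\<close> inherits the same rate.\<close>

lemma arrow_hurwicz_linear_decay:
  fixes A :: "'a :: {real_inner, complete_space} \<Rightarrow>\<^sub>L 'b :: {real_inner, complete_space}"
    and u :: "real \<Rightarrow> 'a" and v :: "real \<Rightarrow> 'b"
  defines "A' \<equiv> adjoint (blinfun_apply A)"
  assumes bounded_below: "\<And>y. (norm (A' y))\<^sup>2 \<ge> \<beta> * (norm y)\<^sup>2"
    and u: "\<And>t. t \<ge> 0 \<Longrightarrow>
              (u has_vector_derivative - \<alpha> *\<^sub>R u t - A' (v t)) (at t within {0..})"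
    and v: "\<And>t. t \<ge> 0 \<Longrightarrow> (v has_vector_derivative blinfun_apply A (u t)) (at t within {0..})"
    and r: "2 * r \<le> \<alpha>" "r < \<alpha>" "r * (\<alpha> - r) \<le> \<beta>" and c: "c \<ge> 0"
    and nondegenerate: "2 * r < \<alpha> \<or> r * (\<alpha> - r) < \<beta> \<or> c > 0"
  obtains K where "K \<ge> 0"
    "\<And>t. t \<ge> 0 \<Longrightarrow> norm (u t) \<le> K * ((1 + c * t) * exp (- r * t))"
    "\<And>t. t \<ge> 0 \<Longrightarrow> norm (v t) \<le> K * ((1 + c * t) * exp (- r * t))"
proof -
  interpret A': bounded_linear A' unfolding A'_def by (rule bounded_linear_adjoint_blinfun)
  define z where "z t = exp (r * t) *\<^sub>R v t" for t
  \<comment> \<open>The derivative of \<open>z\<close>, with \<open>A (u t)\<close> in place of the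
    derivative of \<open>v\<close>.\<close>
  define y where "y t = exp (r * t) *\<^sub>R (blinfun_apply A (u t) + r *\<^sub>R v t)" for t
  define \<kappa> where "\<kappa> = r * (\<alpha> - r)"
  have exp_deriv: "((\<lambda>t. exp (s * t)) has_real_derivative s * exp (s * t)) (at t within {0..})"
    for s t :: real
    by (auto intro!: derivative_eq_intros)
  have Au: "((\<lambda>t. blinfun_apply A (u t)) has_vector_derivative
      blinfun_apply A (- \<alpha> *\<^sub>R u t - A' (v t))) (at t within {0..})" if "t \<ge> 0" for t
    by (rule bounded_linear.has_vector_derivative[OF blinfun.bounded_linear_right u[OF that]])
  have z: "(z has_vector_derivative y t) (at t within {0..})" if "t \<ge> 0" for t
    unfolding z_def
    by (rule has_vector_derivative_eq_rhs[OF has_vector_derivative_scaleR[OF exp_deriv v[OF that]]])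
       (simp add: y_def algebra_simps)
  \<comment> \<open>Splits numeric factors 2 inside scalar coefficients so that the terms of the
    second-order equation match after expansion.\<close>
  have double: "(p * (2 * q)) *\<^sub>R w = (p * q) *\<^sub>R w + (p * q) *\<^sub>R w"
    "(p * (p' * (2 * q))) *\<^sub>R w = (p * (p' * q)) *\<^sub>R w + (p * (p' * q)) *\<^sub>R w"
    for p p' q and w :: 'b
    by (simp_all flip: scaleR_add_left)
  have y: "(y has_vector_derivative
      - (\<alpha> - 2 * r) *\<^sub>R y t - (blinfun_apply A (A' (z t)) - \<kappa> *\<^sub>R z t)) (at t within {0..})"
    if "t \<ge> 0" for t
    unfolding y_def
    by (rule has_vector_derivative_eq_rhs[OF has_vector_derivative_scaleR[OF exp_deriv
          has_vector_derivative_add[OF Au[OF that] has_vector_derivative_scaleR[OF _ v[OF that]]]]])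
       (auto intro!: derivative_eq_intros simp: y_def z_def \<kappa>_def A'.scaleR blinfun.scaleR_right
          blinfun.add_right blinfun.diff_right blinfun.minus_right algebra_simps double)
  obtain K where K: "K \<ge> 0" "\<And>t. t \<ge> 0 \<Longrightarrow> norm (z t) \<le> K * (1 + c * t)"
  proof (rule damped_oscillator_growth)
    show "\<beta> * (norm w)\<^sup>2 \<le> (norm (adjoint (blinfun_apply A) w))\<^sup>2" for w
      using bounded_below unfolding A'_def .
    show "(z has_vector_derivative y t) (at t within {0..})"
      "(y has_vector_derivative - (\<alpha> - 2 * r) *\<^sub>R y t
          - (blinfun_apply A (adjoint (blinfun_apply A) (z t)) - \<kappa> *\<^sub>R z t)) (at t within {0..})"
      if "t \<ge> 0" for t
      using z[OF that] y[OF that] unfolding A'_def .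
    show "\<alpha> - 2 * r \<ge> 0" "\<kappa> \<le> \<beta>" "c \<ge> 0" "\<alpha> - 2 * r > 0 \<or> \<kappa> < \<beta> \<or> c > 0"
      using r c nondegenerate unfolding \<kappa>_def by auto
  qed blast
  have v_le: "norm (v t) \<le> K * ((1 + c * t) * exp (- r * t))" if "t \<ge> 0" for t
  proof -
    have "norm (v t) = norm (z t) * exp (- r * t)"
      by (simp add: z_def exp_minus field_simps)
    also have "\<dots> \<le> (K * (1 + c * t)) * exp (- r * t)"
      using K that by (intro mult_right_mono) auto
    finally show ?thesis by (simp add: mult.assoc)
  qed
  obtain N where N: "N \<ge> 0" "\<And>y. norm (A' y) \<le> norm y * N"
    using A'.nonneg_bounded by blast
  \<comment> \<open>The integrating factor removes the damping term from the equation for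
    \<open>u\<close>.\<close>
  define g where "g t = exp (\<alpha> * t) *\<^sub>R u t" for t
  have g: "(g has_vector_derivative - exp (\<alpha> * t) *\<^sub>R A' (v t)) (at t within {0..})"
    if "t \<ge> 0" for t
    unfolding g_def
    by (rule has_vector_derivative_eq_rhs[OF has_vector_derivative_scaleR[OF exp_deriv u[OF that]]])
       (simp add: algebra_simps)
  define s where "s = \<alpha> - r"
  have s: "s > 0" using r by (simp add: s_def)
  \<comment> \<open>Dividing by \<open>s\<close> compensates the factor \<open>s\<close> from
    differentiating \<open>exp (s * t)\<close>. The other term of the product rule, with factor
    \<open>c\<close>, is nonnegative and only enlarges the majorant.\<close>
  define C where "C = N * K / s"
  have C: "C \<ge> 0" using N K s by (simp add: C_def)
  have \<phi>: "((\<lambda>t. C * ((1 + c * t) * exp (s * t))) has_vector_derivative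
      C * (c * exp (s * t) + (1 + c * t) * (s * exp (s * t)))) (at t within {0..})" for t
    unfolding has_real_derivative_iff_has_vector_derivative[symmetric]
    by (auto intro!: derivative_eq_intros)
  have g': "norm (- exp (\<alpha> * t) *\<^sub>R A' (v t))
      \<le> C * (c * exp (s * t) + (1 + c * t) * (s * exp (s * t)))" if t: "t \<ge> 0" for t
  proof -
    have "norm (- exp (\<alpha> * t) *\<^sub>R A' (v t)) = exp (\<alpha> * t) * norm (A' (v t))" by simp
    also have "\<dots> \<le> exp (\<alpha> * t) * (K * ((1 + c * t) * exp (- r * t)) * N)"
      using v_le[OF t] N by (intro mult_left_mono order_trans[OF N(2)] mult_right_mono) auto
    also have "\<dots> = N * K * (1 + c * t) * (exp (\<alpha> * t) * exp (- r * t))"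
      by (simp add: ac_simps)
    also have "exp (\<alpha> * t) * exp (- r * t) = exp (s * t)"
      by (simp add: s_def algebra_simps flip: exp_add)
    also have "N * K * (1 + c * t) * exp (s * t) = C * ((1 + c * t) * (s * exp (s * t)))"
      using s by (simp add: C_def)
    also have "\<dots> \<le> C * (c * exp (s * t) + (1 + c * t) * (s * exp (s * t)))"
      using C c by (intro mult_left_mono) auto
    finally show ?thesis .
  qed
  have u_le: "norm (u t) \<le> (norm (u 0) + C) * ((1 + c * t) * exp (- r * t))" if t: "t \<ge> 0" for t
  proof -
    have "norm (g t - g 0) \<le> C * ((1 + c * t) * exp (s * t)) - C * ((1 + c * 0) * exp (s * 0))"
      by (rule halfline_norm_increment_le[OF g \<phi> g' t])
    also have "\<dots> \<le> C * ((1 + c * t) * exp (s * t))" using C by simp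
    finally have "norm (g t) \<le> norm (u 0) * 1 + C * ((1 + c * t) * exp (s * t))"
      using norm_triangle_sub[of "g t" "g 0"] by (simp add: g_def)
    also have "\<dots> \<le> norm (u 0) * ((1 + c * t) * exp (s * t)) + C * ((1 + c * t) * exp (s * t))"
    proof -
      have "1 * 1 \<le> (1 + c * t) * exp (s * t)"
        using c t s by (intro mult_mono) auto
      then show ?thesis by (intro add_right_mono mult_left_mono) auto
    qed
    finally have "exp (- \<alpha> * t) * norm (g t)
        \<le> exp (- \<alpha> * t) * ((norm (u 0) + C) * ((1 + c * t) * exp (s * t)))"
      by (intro mult_left_mono) (auto simp: algebra_simps)
    also have "\<dots> = (norm (u 0) + C) * ((1 + c * t) * (exp (- \<alpha> * t) * exp (s * t)))"
      by (simp add: ac_simps)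
    also have "exp (- \<alpha> * t) * exp (s * t) = exp (- r * t)"
      by (simp add: s_def algebra_simps flip: exp_add)
    also have "exp (- \<alpha> * t) * norm (g t) = norm (u t)"
      by (simp add: g_def exp_minus)
    finally show ?thesis .
  qed
  show ?thesis
  proof (rule that)
    let ?K = "norm (u 0) + C + K"
    show "?K \<ge> 0" using C K by simp
    fix t :: real assume t: "t \<ge> 0"
    have "0 \<le> (1 + c * t) * exp (- r * t)" using c t by simp
    then have "(norm (u 0) + C) * ((1 + c * t) * exp (- r * t)) \<le> ?K * ((1 + c * t) * exp (- r * t))"
      "K * ((1 + c * t) * exp (- r * t)) \<le> ?K * ((1 + c * t) * exp (- r * t))"
      using C K by (auto intro!: mult_right_mono)
    with u_le[OF t] v_le[OF t]
    show "norm (u t) \<le> ?K * ((1 + c * t) * exp (- r * t))"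
      "norm (v t) \<le> ?K * ((1 + c * t) * exp (- r * t))" by linarith+
  qed
qed

section \<open>From the differential system to the convergence rates\<close>

lemma C1_halfline_PairD:
  assumes "C1_halfline (\<lambda>t. (x t, l t))" and "t \<ge> 0"
  shows "(x has_vector_derivative time_deriv x t) (at t within {0..})"
    and "(l has_vector_derivative time_deriv l t) (at t within {0..})"
proof -
  have "(\<lambda>t. (x t, l t)) differentiable (at t within {0..})"
    using assms unfolding C1_halfline_def differentiable_on_def by simp
  then obtain D where D: "((\<lambda>t. (x t, l t)) has_derivative D) (at t within {0..})"
    unfolding differentiable_def by blast
  have "x differentiable (at t within {0..})" "l differentiable (at t within {0..})"
    using has_derivative_fst[OF D] has_derivative_snd[OF D] by (auto intro: differentiableI)
  then show "(x has_vector_derivative time_deriv x t) (at t within {0..})"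
    "(l has_vector_derivative time_deriv l t) (at t within {0..})"
    unfolding time_deriv_def by (simp_all add: vector_derivative_works)
qed

theorem corollary4p7:
  fixes f :: "'a :: {real_inner, complete_space} \<Rightarrow> real"
    and gradf :: "'a \<Rightarrow> 'a"
    and H :: "'a \<Rightarrow> 'a \<Rightarrow>\<^sub>L 'a"
    and A :: "'a \<Rightarrow>\<^sub>L 'b :: {real_inner, complete_space}"
    and b :: 'b
    and \<alpha> \<beta> :: real
    and x :: "real \<Rightarrow> 'a" and l :: "real \<Rightarrow> 'b"
    and x\<^sub>0 :: 'a and l\<^sub>0 :: 'b
  assumes convex: "convex_on UNIV f"
    and C1: "C1_gradient f gradf"
    and lipschitz: "lipschitz_on_bounded_sets gradf"
    and C2: "C2_hessian f gradf H"
    and alpha: "\<alpha> > 0"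
    and hessian: "\<And>u. H u = \<alpha> *\<^sub>R id_blinfun"
    and beta: "\<beta> > 0"
    and bounded_below: "\<And>y. (norm (adjoint (blinfun_apply A) y))\<^sup>2 \<ge> \<beta> * (norm y)\<^sup>2"
    and solution: "AH_solution gradf A b x\<^sub>0 l\<^sub>0 x l"
  shows "(\<exists>!p. p \<in> saddle_points (lagrangian f A b)) \<and>
    (\<forall>\<xi> \<eta>. (\<xi>, \<eta>) \<in> saddle_points (lagrangian f A b) \<longrightarrow>
      (\<alpha>\<^sup>2 < 4 * \<beta> \<longrightarrow>
           ((\<lambda>t. lagrangian f A b (x t) \<eta> - lagrangian f A b \<xi> (l t)) \<in> O[at_top](\<lambda>t. exp (- \<alpha> * t)) \<and>
            (\<lambda>t. (norm (time_deriv x t, time_deriv l t))\<^sup>2) \<in> O[at_top](\<lambda>t. exp (- \<alpha> * t)) \<and>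
            (\<lambda>t. (norm ((x t, l t) - (\<xi>, \<eta>)))\<^sup>2) \<in> O[at_top](\<lambda>t. exp (- \<alpha> * t)))) \<and>
      (\<alpha>\<^sup>2 = 4 * \<beta> \<longrightarrow>
           ((\<lambda>t. lagrangian f A b (x t) \<eta> - lagrangian f A b \<xi> (l t)) \<in> O[at_top](\<lambda>t. t\<^sup>2 * exp (- \<alpha> * t)) \<and>
            (\<lambda>t. (norm (time_deriv x t, time_deriv l t))\<^sup>2) \<in> O[at_top](\<lambda>t. t\<^sup>2 * exp (- \<alpha> * t)) \<and>
            (\<lambda>t. (norm ((x t, l t) - (\<xi>, \<eta>)))\<^sup>2) \<in> O[at_top](\<lambda>t. t\<^sup>2 * exp (- \<alpha> * t)))) \<and>
      (\<alpha>\<^sup>2 > 4 * \<beta> \<longrightarrow> (let \<delta> = sqrt (\<alpha>\<^sup>2 - 4 * \<beta>) in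
           ((\<lambda>t. lagrangian f A b (x t) \<eta> - lagrangian f A b \<xi> (l t)) \<in> O[at_top](\<lambda>t. exp (- (\<alpha> - \<delta>) * t)) \<and>
            (\<lambda>t. (norm (time_deriv x t, time_deriv l t))\<^sup>2) \<in> O[at_top](\<lambda>t. exp (- (\<alpha> - \<delta>) * t)) \<and>
            (\<lambda>t. (norm ((x t, l t) - (\<xi>, \<eta>)))\<^sup>2) \<in> O[at_top](\<lambda>t. exp (- (\<alpha> - \<delta>) * t))))))"
proof -
  let ?A' = "adjoint (blinfun_apply A)"
  interpret A': bounded_linear ?A' by (rule bounded_linear_adjoint_blinfun)
  have x_deriv: "(x has_vector_derivative time_deriv x t) (at t within {0..})"
    and l_deriv: "(l has_vector_derivative time_deriv l t) (at t within {0..})" if "t \<ge> 0" for t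
    using solution C1_halfline_PairD that unfolding AH_solution_def by blast+
  have x_eq: "time_deriv x t = - gradf (x t) - ?A' (l t)"
    and l_eq: "time_deriv l t = blinfun_apply A (x t) - b" if "t \<ge> 0" for t
  proof -
    have "time_deriv x t + gradf (x t) + ?A' (l t) = 0"
      and "time_deriv l t + b - blinfun_apply A (x t) = 0"
      using solution that unfolding AH_solution_def by blast+
    moreover have "time_deriv x t
        = (time_deriv x t + gradf (x t) + ?A' (l t)) - gradf (x t) - ?A' (l t)"
      and "time_deriv l t
        = (time_deriv l t + b - blinfun_apply A (x t)) + (blinfun_apply A (x t) - b)"
      by simp_all
    ultimately show "time_deriv x t = - gradf (x t) - ?A' (l t)"
      "time_deriv l t = blinfun_apply A (x t) - b" by simp_all
  qed
  \<comment> \<open>All three regimes are instances of this statement; they differ only in the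
    exponent \<open>r\<close>, the growth slope \<open>c\<close> and the comparison function
    \<open>G\<close>.\<close>
  have rates: "(\<lambda>t. lagrangian f A b (x t) \<eta> - lagrangian f A b \<xi> (l t)) \<in> O[at_top](G) \<and>
      (\<lambda>t. (norm (time_deriv x t, time_deriv l t))\<^sup>2) \<in> O[at_top](G) \<and>
      (\<lambda>t. (norm ((x t, l t) - (\<xi>, \<eta>)))\<^sup>2) \<in> O[at_top](G)"
    if saddle: "(\<xi>, \<eta>) \<in> saddle_points (lagrangian f A b)"
      and r: "2 * r \<le> \<alpha>" "r < \<alpha>" "r * (\<alpha> - r) \<le> \<beta>" and c: "c \<ge> 0"
      and nondegenerate: "2 * r < \<alpha> \<or> r * (\<alpha> - r) < \<beta> \<or> c > 0"
      and G: "(\<lambda>t. ((1 + c * t) * exp (- r * t))\<^sup>2) \<in> O[at_top](G)"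
    for \<xi> \<eta> r c G
  proof -
    have \<xi>: "blinfun_apply A \<xi> = b" and \<eta>: "gradf \<xi> = - ?A' \<eta>"
      using saddle saddle_points_lagrangian_iff[OF C2 hessian] alpha
      by (auto simp: eq_neg_iff_add_eq_0)
    define u where "u t = x t - \<xi>" for t
    define v where "v t = l t - \<eta>" for t
    have x_eq': "time_deriv x t = - \<alpha> *\<^sub>R u t - ?A' (v t)" if "t \<ge> 0" for t
      unfolding x_eq[OF that] affine_gradient_if_hessian_scalar[OF C2 hessian, of "x t" \<xi>] \<eta>
      by (simp add: u_def v_def A'.diff)
    have l_eq': "time_deriv l t = blinfun_apply A (u t)" if "t \<ge> 0" for t
      unfolding l_eq[OF that] by (simp add: u_def blinfun.diff_right \<xi>)
    have u: "(u has_vector_derivative - \<alpha> *\<^sub>R u t - ?A' (v t)) (at t within {0..})"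
      if "t \<ge> 0" for t
      using x_deriv[OF that] unfolding x_eq'[OF that, symmetric] unfolding u_def
      by (simp add: has_vector_derivative_diff_const)
    have v: "(v has_vector_derivative blinfun_apply A (u t)) (at t within {0..})"
      if "t \<ge> 0" for t
      using l_deriv[OF that] unfolding l_eq'[OF that, symmetric] unfolding v_def
      by (simp add: has_vector_derivative_diff_const)
    define g where "g t = (1 + c * t) * exp (- r * t)" for t
    obtain K where K: "K \<ge> 0" "\<And>t. t \<ge> 0 \<Longrightarrow> norm (u t) \<le> K * g t"
      "\<And>t. t \<ge> 0 \<Longrightarrow> norm (v t) \<le> K * g t"
      using arrow_hurwicz_linear_decay[OF bounded_below u v r c nondegenerate]
      unfolding g_def by metis
    have g_nonneg: "g t \<ge> 0" if "t \<ge> 0" for t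
      using that c by (simp add: g_def)
    \<comment> \<open>Serves \<open>u\<close>, the velocity and the deviation in the product space,
      each bounded by a multiple of \<open>g\<close>.\<close>
    have square: "(\<lambda>t. (norm (w t))\<^sup>2) \<in> O[at_top](G)"
      if w: "\<And>t. t \<ge> 0 \<Longrightarrow> norm (w t) \<le> C * g t" for w :: "real \<Rightarrow> 'c :: real_normed_vector" and C
    proof -
      have "eventually (\<lambda>t. norm (norm (w t)) \<le> C * norm (g t)) at_top"
        using eventually_ge_at_top[of 0]
      proof eventually_elim
        case (elim t)
        then show ?case using w g_nonneg by simp
      qed
      then have "(\<lambda>t. norm (w t)) \<in> O[at_top](g)" by (rule bigoI)
      then have "(\<lambda>t. (norm (w t))\<^sup>2) \<in> O[at_top](\<lambda>t. (g t)\<^sup>2)"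
        by (rule landau_o.big_power)
      with G show ?thesis unfolding g_def by (blast intro: landau_o.big_trans)
    qed
    obtain N where N: "N \<ge> 0" "\<And>y. norm (?A' y) \<le> norm y * N"
      using A'.nonneg_bounded by blast
    \<comment> \<open>As \<open>A \<xi> = b\<close>, the second Lagrangian is
      \<open>f \<xi>\<close>; the linear term of the expansion of \<open>f\<close> at
      \<open>\<xi>\<close> cancels the multiplier term of the first.\<close>
    have "(\<lambda>t. lagrangian f A b (x t) \<eta> - lagrangian f A b \<xi> (l t))
        = (\<lambda>t. \<alpha> / 2 * (norm (u t))\<^sup>2)"
    proof
      fix t
      have "?A' \<eta> \<bullet> (x t - \<xi>) = \<eta> \<bullet> (blinfun_apply A (x t) - b)"
        by (metis \<xi> blinfun.diff_right inner_adjoint_blinfun inner_commute)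
      then show "lagrangian f A b (x t) \<eta> - lagrangian f A b \<xi> (l t) = \<alpha> / 2 * (norm (u t))\<^sup>2"
        using quadratic_expansion_if_hessian_scalar[OF C2 hessian, of "x t" \<xi>]
        by (simp add: lagrangian_def \<xi> \<eta> u_def)
    qed
    moreover have "(\<lambda>t. \<alpha> / 2 * (norm (u t))\<^sup>2) \<in> O[at_top](G)"
      using square[of u K] K by simp
    moreover have "(\<lambda>t. (norm (time_deriv x t, time_deriv l t))\<^sup>2) \<in> O[at_top](G)"
    proof (rule square)
      fix t :: real assume t: "t \<ge> 0"
      have "norm (time_deriv x t, time_deriv l t) \<le> norm (time_deriv x t) + norm (time_deriv l t)"
        by (rule norm_Pair_le)
      also have "norm (time_deriv x t) \<le> \<alpha> * norm (u t) + norm (v t) * N"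
        unfolding x_eq'[OF t] using alpha N(2)[of "v t"]
        by (intro order_trans[OF norm_triangle_ineq4]) simp
      also have "norm (time_deriv l t) \<le> norm A * norm (u t)"
        unfolding l_eq'[OF t] by (rule norm_blinfun)
      also have "\<alpha> * norm (u t) + norm (v t) * N + norm A * norm (u t)
          \<le> \<alpha> * (K * g t) + (K * g t) * N + norm A * (K * g t)"
        using alpha N K t by (intro add_mono mult_left_mono mult_right_mono) auto
      finally show "norm (time_deriv x t, time_deriv l t) \<le> (\<alpha> * K + K * N + norm A * K) * g t"
        by (simp add: algebra_simps)
    qed
    moreover have "(\<lambda>t. (norm ((x t, l t) - (\<xi>, \<eta>)))\<^sup>2) \<in> O[at_top](G)"
    proof (rule square)
      fix t :: real assume t: "t \<ge> 0"
      have "norm ((x t, l t) - (\<xi>, \<eta>)) \<le> norm (u t) + norm (v t)"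
        unfolding u_def v_def diff_Pair by (rule norm_Pair_le)
      also have "\<dots> \<le> (K + K) * g t"
        unfolding distrib_right by (intro add_mono K t)
      finally show "norm ((x t, l t) - (\<xi>, \<eta>)) \<le> (K + K) * g t" .
    qed
    ultimately show ?thesis by simp
  qed
  show ?thesis
  proof (intro conjI[OF ex1_saddle_point_lagrangian[OF C2 hessian alpha beta bounded_below]]
      allI impI)
    fix \<xi> \<eta> assume saddle: "(\<xi>, \<eta>) \<in> saddle_points (lagrangian f A b)"
    let ?rates = "\<lambda>G. (\<lambda>t. lagrangian f A b (x t) \<eta> - lagrangian f A b \<xi> (l t)) \<in> O[at_top](G) \<and>
      (\<lambda>t. (norm (time_deriv x t, time_deriv l t))\<^sup>2) \<in> O[at_top](G) \<and>
      (\<lambda>t. (norm ((x t, l t) - (\<xi>, \<eta>)))\<^sup>2) \<in> O[at_top](G)"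
    \<comment> \<open>Here \<open>r * (\<alpha> - r) = \<alpha>\<^sup>2 / 4 < \<beta>\<close>, so
      the form is coercive and \<open>c = 0\<close> is allowed.\<close>
    have underdamped: "?rates (\<lambda>t. exp (- \<alpha> * t))" if "\<alpha>\<^sup>2 < 4 * \<beta>"
    proof (rule rates[OF saddle, where r = "\<alpha> / 2" and c = 0])
      show "(\<lambda>t. ((1 + 0 * t) * exp (- (\<alpha> / 2) * t))\<^sup>2) \<in> O(\<lambda>t. exp (- \<alpha> * t))"
        by (simp add: power2_eq_square mult.commute flip: exp_add)
    qed (use alpha that in \<open>auto simp: power2_eq_square\<close>)
    \<comment> \<open>Now \<open>2 * r = \<alpha>\<close> and
      \<open>r * (\<alpha> - r) = \<beta>\<close>, so only \<open>c > 0\<close> meets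
      \<open>nondegenerate\<close>; squaring the linear factor gives
      \<open>t\<^sup>2\<close>.\<close>
    have critical: "?rates (\<lambda>t. t\<^sup>2 * exp (- \<alpha> * t))" if "\<alpha>\<^sup>2 = 4 * \<beta>"
    proof (rule rates[OF saddle, where r = "\<alpha> / 2" and c = 1])
      have "eventually (\<lambda>t :: real. norm (1 + 1 * t) \<le> 2 * norm t) at_top"
        using eventually_ge_at_top[of "1 :: real"] by eventually_elim simp
      then have "(\<lambda>t. 1 + 1 * t) \<in> O(\<lambda>t. t :: real)" by (rule bigoI)
      then have "(\<lambda>t. ((1 + 1 * t) * exp (- (\<alpha> / 2) * t))\<^sup>2) \<in> O(\<lambda>t. (t * exp (- (\<alpha> / 2) * t))\<^sup>2)"
        by (intro landau_o.big_power landau_o.big.mult landau_o.big_refl)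
      also have "(\<lambda>t. (t * exp (- (\<alpha> / 2) * t))\<^sup>2) = (\<lambda>t. t\<^sup>2 * exp (- \<alpha> * t))"
        by (simp add: fun_eq_iff power_mult_distrib flip: exp_double)
      finally show "(\<lambda>t. ((1 + 1 * t) * exp (- (\<alpha> / 2) * t))\<^sup>2) \<in> O(\<lambda>t. t\<^sup>2 * exp (- \<alpha> * t))" .
    qed (use alpha that in \<open>auto simp: power2_eq_square\<close>)
    have overdamped: "let \<delta> = sqrt (\<alpha>\<^sup>2 - 4 * \<beta>) in ?rates (\<lambda>t. exp (- (\<alpha> - \<delta>) * t))"
      if "\<alpha>\<^sup>2 > 4 * \<beta>"
    proof -
      \<comment> \<open>The exponent \<open>(\<alpha> - \<delta>) / 2\<close> is the smaller root of
        \<open>r * (\<alpha> - r) = \<beta>\<close>. Since \<open>2 * r < \<alpha>\<close>, friction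
        remains after rescaling and \<open>c = 0\<close> is allowed.\<close>
      define \<delta> where "\<delta> = sqrt (\<alpha>\<^sup>2 - 4 * \<beta>)"
      have \<delta>: "\<delta> > 0" "\<delta>\<^sup>2 = \<alpha>\<^sup>2 - 4 * \<beta>" using that by (auto simp: \<delta>_def)
      have "?rates (\<lambda>t. exp (- (\<alpha> - \<delta>) * t))"
      proof (rule rates[OF saddle, where r = "(\<alpha> - \<delta>) / 2" and c = 0])
        show "(\<alpha> - \<delta>) / 2 * (\<alpha> - (\<alpha> - \<delta>) / 2) \<le> \<beta>"
          using \<delta>(2) by (simp add: field_simps power2_eq_square)
        have "((1 + 0 * t) * exp (- ((\<alpha> - \<delta>) / 2) * t))\<^sup>2 = exp (- (\<alpha> - \<delta>) * t)" for t
          by (simp add: power2_eq_square field_simps flip: exp_add)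
        then show "(\<lambda>t. ((1 + 0 * t) * exp (- ((\<alpha> - \<delta>) / 2) * t))\<^sup>2) \<in> O(\<lambda>t. exp (- (\<alpha> - \<delta>) * t))"
          by simp
      qed (use alpha \<delta> in auto)
      then show ?thesis unfolding Let_def \<delta>_def .
    qed
    show "(\<alpha>\<^sup>2 < 4 * \<beta> \<longrightarrow> ?rates (\<lambda>t. exp (- \<alpha> * t))) \<and>
      (\<alpha>\<^sup>2 = 4 * \<beta> \<longrightarrow> ?rates (\<lambda>t. t\<^sup>2 * exp (- \<alpha> * t))) \<and>
      (\<alpha>\<^sup>2 > 4 * \<beta> \<longrightarrow>
        (let \<delta> = sqrt (\<alpha>\<^sup>2 - 4 * \<beta>) in ?rates (\<lambda>t. exp (- (\<alpha> - \<delta>) * t))))"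
      by (rule conjI[OF impI[OF underdamped] conjI[OF impI[OF critical] impI[OF overdamped]]])
  qed
qed

end
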